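(* Let $G$ be a graph. The parameter $\chi_q(G)$ is equal to the minimum integer $t$ for which there exists a matrix $X\in\mathcal{CS}_+^{|V(G)|t+1}$, indexed by $(V(G)\times[t])\cup\{0\}$, satisfying: (C1) $X_{0,0}=1$; (C3a) $\sum_{i\in[t]}X_{0,ui}=1$ for all $u\in V(G)$; (C3b) $\sum_{i,j\in[t]}X_{ui,uj}=1$ for all $u\in V(G)$; (O3) $X_{ui,vi}=0$ for all $i\in[t]$ and all $\{u,v\}\in E(G)$; (O4) $X_{ui,uj}=0$ for all $i\ne j\in[t]$ and all $u\in V(G)$. Moreover, the parameter $\chi^\star(G)$ is equal to the minimum integer $t$ for which there exists a matrix $X\in\mathcal{CS}_+^{|V(G)|t+1}$ satisfying (C1), (C3a), (C3b) and (O3).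
   Context: Graphs are finite, undirected, without loops, with at least one vertex; $[t]=\{1,\dots,t\}$ with $t\ge1$; $ui$ abbreviates the index $(u,i)$. $\mathcal S^d$ denotes the real symmetric $d\times d$ matrices with trace inner product $\langle X,Y\rangle=\mathrm{Tr}(XY)$, and $\mathcal S^d_+$ the positive semidefinite ones. $\mathcal{CS}_+^m$ is the set of $A\in\mathcal S^m$ for which there exist $d\ge1$ and $X_1,\dots,X_m\in\mathcal S^d_+$ with $A_{ij}=\langle X_i,X_j\rangle$ for all $i,j$. $\chi_q(G)$ is the minimum $t\in\mathbb N$ for which there exist $d\ge1$ and $\rho,\rho_u^i\in\mathcal S^d_+$ ($i\in[t]$, $u\in V(G)$) with: (a) $\langle\rho,\rho\rangle=1$; (b) $\sum_{i\in[t]}\rho_u^i=\rho$ for all $u\in V(G)$; (c) $\langle\rho_u^i,\rho_v^i\rangle=0$ for all $i\in[t]$ and $\{u,v\}\in E(G)$; (d) $\langle\rho_u^i,\rho_u^j\rangle=0$ for all $i\ne j\in[t]$ and $u\in V(G)$. $\chi^\star(G)$ is defined in the same way with only conditions (a), (b), (c). *)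

theory Defs
  imports "Jordan_Normal_Form.Matrix" "Graph_Theory.Digraph"
begin

text \<open>
  A finite simple undirected graph is a \<^locale>\<open>graph\<close> in the sense of \<^theory>\<open>Graph_Theory.Digraph\<close>,
  i.e. a finite symmetric loop-free digraph without parallel arcs: an edge \<open>{u, v}\<close> is the pair of
  arcs from \<open>u\<close> to \<open>v\<close> and from \<open>v\<close> to \<open>u\<close>, and \<open>u \<rightarrow>\<^bsub>G\<^esub> v\<close> is adjacency. That locale
  allows the null graph, so nonemptiness of the vertex set is a separate assumption.
\<close>

definition trace_mat :: "real mat \<Rightarrow> real" where
  "trace_mat A = (\<Sum>k<dim_row A. A $$ (k, k))"

definition trace_inner :: "real mat \<Rightarrow> real mat \<Rightarrow> real" where
  "trace_inner X Y = trace_mat (X * Y)"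

definition psd_mats :: "nat \<Rightarrow> real mat set" where
  "psd_mats d = {A \<in> carrier_mat d d. transpose_mat A = A \<and>
     (\<forall>x \<in> carrier_vec d. 0 \<le> x \<bullet> (A *\<^sub>v x))}"

text \<open>
  Matrices of a fixed shape are not a type, so \<^const>\<open>sum\<close> is not available for them; this is the
  sum of a family of \<open>d \<times> d\<close> matrices.
\<close>

definition mat_sum :: "nat \<Rightarrow> ('i \<Rightarrow> real mat) \<Rightarrow> 'i set \<Rightarrow> real mat" where
  "mat_sum d F I = mat d d (\<lambda>(a, b). \<Sum>i\<in>I. F i $$ (a, b))"

text \<open>
  The completely positive semidefinite cone, for matrices whose rows and columns are indexed by a
  finite set \<open>I\<close>; the cone of order \<open>m\<close> is the case \<open>card I = m\<close>. A matrix is a function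
  on pairs of indices, and only its values on \<open>I \<times> I\<close> matter.
\<close>

definition cs_plus :: "'i set \<Rightarrow> ('i \<Rightarrow> 'i \<Rightarrow> real) set" where
  "cs_plus I = {A. (\<forall>i\<in>I. \<forall>j\<in>I. A i j = A j i) \<and>
     (\<exists>d\<ge>1. \<exists>X. (\<forall>i\<in>I. X i \<in> psd_mats d) \<and>
        (\<forall>i\<in>I. \<forall>j\<in>I. A i j = trace_inner (X i) (X j)))}"

definition is_minimum :: "nat \<Rightarrow> (nat \<Rightarrow> bool) \<Rightarrow> bool" where
  "is_minimum m P \<longleftrightarrow> P m \<and> (\<forall>n. P n \<longrightarrow> m \<le> n)"

definition star_assignment ::
  "('v, 'e) pre_digraph \<Rightarrow> nat \<Rightarrow> nat \<Rightarrow> real mat \<Rightarrow> ('v \<Rightarrow> nat \<Rightarrow> real mat) \<Rightarrow> bool" where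
  "star_assignment G t d \<rho> R \<longleftrightarrow>
     \<rho> \<in> psd_mats d \<and> (\<forall>u \<in> verts G. \<forall>i \<in> {1..t}. R u i \<in> psd_mats d) \<and>
     trace_inner \<rho> \<rho> = 1 \<and>
     (\<forall>u \<in> verts G. mat_sum d (R u) {1..t} = \<rho>) \<and>
     (\<forall>i \<in> {1..t}. \<forall>u v. u \<rightarrow>\<^bsub>G\<^esub> v \<longrightarrow> trace_inner (R u i) (R v i) = 0)"

definition quantum_assignment ::
  "('v, 'e) pre_digraph \<Rightarrow> nat \<Rightarrow> nat \<Rightarrow> real mat \<Rightarrow> ('v \<Rightarrow> nat \<Rightarrow> real mat) \<Rightarrow> bool" where
  "quantum_assignment G t d \<rho> R \<longleftrightarrow> star_assignment G t d \<rho> R \<and>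
     (\<forall>u \<in> verts G. \<forall>i \<in> {1..t}. \<forall>j \<in> {1..t}. i \<noteq> j \<longrightarrow> trace_inner (R u i) (R u j) = 0)"

text \<open>
  For a graph with at least one vertex the two sets below are nonempty (colour each vertex with its
  own colour and take \<open>d = 1\<close>), so \<^const>\<open>Least\<close> is a genuine minimum.
\<close>

definition chi_q :: "('v, 'e) pre_digraph \<Rightarrow> nat" where
  "chi_q G = (LEAST t. t \<ge> 1 \<and> (\<exists>d\<ge>1. \<exists>\<rho> R. quantum_assignment G t d \<rho> R))"

definition chi_star :: "('v, 'e) pre_digraph \<Rightarrow> nat" where
  "chi_star G = (LEAST t. t \<ge> 1 \<and> (\<exists>d\<ge>1. \<exists>\<rho> R. star_assignment G t d \<rho> R))"

text \<open>
  The index set \<open>(V(G) \<times> [t]) \<union> {0}\<close>: the extra index \<open>0\<close> is \<^const>\<open>None\<close> and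
  \<open>ui\<close> is \<open>Some (u, i)\<close>.
\<close>

definition colour_index :: "('v, 'e) pre_digraph \<Rightarrow> nat \<Rightarrow> ('v \<times> nat) option set" where
  "colour_index G t = insert None (Some ` (verts G \<times> {1..t}))"

lemma card_colour_index:
  "finite (verts G) \<Longrightarrow> card (colour_index G t) = card (verts G) * t + 1"
  by (simp add: colour_index_def card_image)

end

theory Submission
  imports Defs
begin

text \<open>
  For each \<open>t\<close> the two feasibility problems are equivalent: a feasible matrix is the Gram matrix of
  an assignment, and conversely. Conditions (C1), (C3a), (C3b) say exactly that
  \<open>\<langle>\<rho>, \<rho>\<rangle> = \<langle>\<rho>, S\<rangle> = \<langle>S, S\<rangle> = 1\<close> for \<open>S = \<Sum>\<^sub>i \<rho>\<^sub>u\<^sup>i\<close>, and then \<open>\<langle>\<rho> - S, \<rho> - S\<rangle> = 0\<close> forces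
  \<open>S = \<rho>\<close>.
\<close>

text \<open>Symmetry of \<open>Y\<close> swaps the indices of its entries in the trace of
  \<open>X * Y\<close>, which turns the trace inner product into the dot product of the two matrices
  read as vectors of entries. Indexing by pairs \<open>p\<close> lets later arguments treat a matrix
  as one flat vector.\<close>

lemma trace_inner_eq_sum:
  assumes "X \<in> carrier_mat d d" "Y \<in> carrier_mat d d" "transpose_mat Y = Y"
  shows "trace_inner X Y = (\<Sum>p\<in>{..<d} \<times> {..<d}. X $$ p * Y $$ p)"
proof -
  have sym: "Y $$ (b, a) = Y $$ (a, b)" if "a < d" "b < d" for a b
    using assms(2,3) that by (metis carrier_matD index_transpose_mat(1))
  have "trace_inner X Y = (\<Sum>a<d. \<Sum>b<d. X $$ (a, b) * Y $$ (b, a))"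
    using assms(1,2)
    by (auto simp: trace_inner_def trace_mat_def scalar_prod_def atLeast0LessThan intro!: sum.cong)
  also have "\<dots> = (\<Sum>a<d. \<Sum>b<d. X $$ (a, b) * Y $$ (a, b))"
    by (intro sum.cong refl) (simp add: sym)
  finally show ?thesis by (simp add: sum.cartesian_product)
qed

lemma trace_inner_psd:
  assumes "X \<in> psd_mats d" "Y \<in> psd_mats d"
  shows "trace_inner X Y = (\<Sum>p\<in>{..<d} \<times> {..<d}. X $$ p * Y $$ p)"
  using assms by (intro trace_inner_eq_sum) (auto simp: psd_mats_def)

lemma trace_inner_psd_commute:
  "X \<in> psd_mats d \<Longrightarrow> Y \<in> psd_mats d \<Longrightarrow> trace_inner X Y = trace_inner Y X"
  by (simp add: trace_inner_psd mult.commute)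

text \<open>Two vectors are equal once their inner product and both squared norms coincide. The sum
  matrix is handled through its entries \<open>S p\<close>, and bilinearity expands its inner
  products into those of the summands, which are entries of a Gram matrix.\<close>

lemma mat_sum_eq_iff:
  assumes \<rho>: "\<rho> \<in> psd_mats d" and R: "\<And>i. i \<in> I \<Longrightarrow> R i \<in> psd_mats d"
  shows "mat_sum d R I = \<rho> \<longleftrightarrow>
    (\<Sum>i\<in>I. trace_inner \<rho> (R i)) = trace_inner \<rho> \<rho> \<and>
    (\<Sum>i\<in>I. \<Sum>j\<in>I. trace_inner (R i) (R j)) = trace_inner \<rho> \<rho>"
proof -
  let ?D = "{..<d} \<times> {..<d}"
  define S where "S p = (\<Sum>i\<in>I. R i $$ p)" for p
  have eq: "mat_sum d R I = \<rho> \<longleftrightarrow> (\<forall>p\<in>?D. S p = \<rho> $$ p)"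
  proof -
    have "dim_row \<rho> = d" "dim_col \<rho> = d" using \<rho> by (auto simp: psd_mats_def)
    then show ?thesis by (auto simp: mat_sum_def S_def mat_eq_iff)
  qed
  have \<rho>\<rho>: "trace_inner \<rho> \<rho> = (\<Sum>p\<in>?D. \<rho> $$ p * \<rho> $$ p)"
    by (rule trace_inner_psd[OF \<rho> \<rho>])
  have "(\<Sum>i\<in>I. trace_inner \<rho> (R i)) = (\<Sum>i\<in>I. \<Sum>p\<in>?D. \<rho> $$ p * R i $$ p)"
    by (intro sum.cong refl trace_inner_psd \<rho> R)
  also have "\<dots> = (\<Sum>p\<in>?D. \<rho> $$ p * S p)"
    by (subst sum.swap) (simp add: S_def sum_distrib_left)
  finally have \<rho>S: "(\<Sum>i\<in>I. trace_inner \<rho> (R i)) = (\<Sum>p\<in>?D. \<rho> $$ p * S p)" .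
  have "(\<Sum>i\<in>I. \<Sum>j\<in>I. trace_inner (R i) (R j)) =
      (\<Sum>i\<in>I. \<Sum>j\<in>I. \<Sum>p\<in>?D. R i $$ p * R j $$ p)"
    by (intro sum.cong refl trace_inner_psd R)
  also have "\<dots> = (\<Sum>i\<in>I. \<Sum>p\<in>?D. R i $$ p * S p)"
    by (intro sum.cong refl, subst sum.swap) (simp add: S_def sum_distrib_left)
  also have "\<dots> = (\<Sum>p\<in>?D. S p * S p)"
    by (subst sum.swap) (simp add: S_def sum_distrib_right)
  finally have SS: "(\<Sum>i\<in>I. \<Sum>j\<in>I. trace_inner (R i) (R j)) = (\<Sum>p\<in>?D. S p * S p)" .
  show ?thesis unfolding eq \<rho>\<rho> \<rho>S SS
  proof (intro iffI conjI)
    assume *: "(\<Sum>p\<in>?D. \<rho> $$ p * S p) = (\<Sum>p\<in>?D. \<rho> $$ p * \<rho> $$ p) \<and>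
      (\<Sum>p\<in>?D. S p * S p) = (\<Sum>p\<in>?D. \<rho> $$ p * \<rho> $$ p)"
    \<comment> \<open>The squared distance from \<open>\<rho>\<close> to \<open>S\<close>; under the
      hypothesis it has the form n - 2n + n, so every entrywise square vanishes.\<close>
    have "(\<Sum>p\<in>?D. (\<rho> $$ p - S p)\<^sup>2) =
        (\<Sum>p\<in>?D. \<rho> $$ p * \<rho> $$ p) - 2 * (\<Sum>p\<in>?D. \<rho> $$ p * S p) + (\<Sum>p\<in>?D. S p * S p)"
      by (simp add: power2_eq_square algebra_simps sum.distrib sum_subtractf sum_distrib_left)
    then have "(\<Sum>p\<in>?D. (\<rho> $$ p - S p)\<^sup>2) = 0" using * by simp
    then show "\<forall>p\<in>?D. S p = \<rho> $$ p" by (subst (asm) sum_nonneg_eq_0_iff) auto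
  qed (auto intro!: sum.cong)
qed

text \<open>Conditions (C1), (C3a), (C3b) and (O3), in the same form as in the theorem, so that
  unfolding reproduces the stated predicate.\<close>

definition star_feasible ::
  "('v, 'e) pre_digraph \<Rightarrow> nat \<Rightarrow> (('v \<times> nat) option \<Rightarrow> ('v \<times> nat) option \<Rightarrow> real) \<Rightarrow> bool" where
  "star_feasible G t X \<longleftrightarrow>
     X None None = 1 \<and>
     (\<forall>u \<in> verts G. (\<Sum>i\<in>{1..t}. X None (Some (u, i))) = 1) \<and>
     (\<forall>u \<in> verts G. (\<Sum>i\<in>{1..t}. \<Sum>j\<in>{1..t}. X (Some (u, i)) (Some (u, j))) = 1) \<and>
     (\<forall>i \<in> {1..t}. \<forall>u v. u \<rightarrow>\<^bsub>G\<^esub> v \<longrightarrow> X (Some (u, i)) (Some (v, i)) = 0)"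

definition quantum_feasible ::
  "('v, 'e) pre_digraph \<Rightarrow> nat \<Rightarrow> (('v \<times> nat) option \<Rightarrow> ('v \<times> nat) option \<Rightarrow> real) \<Rightarrow> bool" where
  "quantum_feasible G t X \<longleftrightarrow> star_feasible G t X \<and>
     (\<forall>u \<in> verts G. \<forall>i \<in> {1..t}. \<forall>j \<in> {1..t}. i \<noteq> j \<longrightarrow> X (Some (u, i)) (Some (u, j)) = 0)"

definition gram :: "('i \<Rightarrow> real mat) \<Rightarrow> 'i \<Rightarrow> 'i \<Rightarrow> real" where
  "gram Y k l = trace_inner (Y k) (Y l)"

text \<open>A single family \<open>Y\<close> holds \<open>\<rho>\<close> at \<open>None\<close> and
  the colour matrices at \<open>Some (u, i)\<close>. Then (a) is (C1) and (c) is (O3) verbatim,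
  while \<open>mat_sum_eq_iff\<close> trades (b) for two equations whose right-hand side (C1)
  normalises to 1.\<close>

lemma star_assignment_iff_gram:
  assumes Y: "\<And>k. k \<in> colour_index G t \<Longrightarrow> Y k \<in> psd_mats d"
  shows "star_assignment G t d (Y None) (\<lambda>u i. Y (Some (u, i))) \<longleftrightarrow> star_feasible G t (gram Y)"
proof -
  have \<rho>: "Y None \<in> psd_mats d" using Y by (simp add: colour_index_def)
  have R: "Y (Some (u, i)) \<in> psd_mats d" if "u \<in> verts G" "i \<in> {1..t}" for u i
    using Y that by (auto simp: colour_index_def)
  have "mat_sum d (\<lambda>i. Y (Some (u, i))) {1..t} = Y None \<longleftrightarrow>
      (\<Sum>i\<in>{1..t}. gram Y None (Some (u, i))) = gram Y None None \<and>
      (\<Sum>i\<in>{1..t}. \<Sum>j\<in>{1..t}. gram Y (Some (u, i)) (Some (u, j))) = gram Y None None"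
    if "u \<in> verts G" for u
    unfolding gram_def using \<rho> R that by (intro mat_sum_eq_iff) auto
  then show ?thesis
    unfolding star_assignment_def star_feasible_def using \<rho> R by (auto simp: gram_def)
qed

lemma quantum_assignment_iff_gram:
  assumes "\<And>k. k \<in> colour_index G t \<Longrightarrow> Y k \<in> psd_mats d"
  shows "quantum_assignment G t d (Y None) (\<lambda>u i. Y (Some (u, i))) \<longleftrightarrow> quantum_feasible G t (gram Y)"
proof -
  have "star_assignment G t d (Y None) (\<lambda>u i. Y (Some (u, i))) \<longleftrightarrow> star_feasible G t (gram Y)"
    using assms by (rule star_assignment_iff_gram)
  then show ?thesis by (simp add: quantum_assignment_def quantum_feasible_def gram_def)
qed

text \<open>Membership in \<open>cs_plus\<close> constrains a function only on the index set, so
  feasibility must not depend on other values. For (O3) this rests on arcs having both ends in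
  \<open>verts G\<close>, which well-formedness supplies.\<close>

lemma star_feasible_cong:
  assumes "wf_digraph G"
    and "\<And>k l. k \<in> colour_index G t \<Longrightarrow> l \<in> colour_index G t \<Longrightarrow> X k l = X' k l"
  shows "star_feasible G t X = star_feasible G t X'"
proof -
  have N: "X None None = X' None None"
    using assms(2) by (simp add: colour_index_def)
  have S: "X None (Some (u, i)) = X' None (Some (u, i))" if "u \<in> verts G" "i \<in> {1..t}" for u i
    using assms(2) that by (simp add: colour_index_def)
  have SS: "X (Some (u, i)) (Some (v, j)) = X' (Some (u, i)) (Some (v, j))"
    if "u \<in> verts G" "v \<in> verts G" "i \<in> {1..t}" "j \<in> {1..t}" for u v i j
    using assms(2) that by (simp add: colour_index_def)
  have adj: "u \<in> verts G \<and> v \<in> verts G" if "u \<rightarrow>\<^bsub>G\<^esub> v" for u v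
    using wf_digraph.adj_in_verts[OF assms(1) that] by simp
  have S1: "(\<Sum>i\<in>{1..t}. X None (Some (u, i))) = (\<Sum>i\<in>{1..t}. X' None (Some (u, i)))"
    if "u \<in> verts G" for u
    using that by (intro sum.cong refl S)
  have S2: "(\<Sum>i\<in>{1..t}. \<Sum>j\<in>{1..t}. X (Some (u, i)) (Some (u, j))) =
      (\<Sum>i\<in>{1..t}. \<Sum>j\<in>{1..t}. X' (Some (u, i)) (Some (u, j)))" if "u \<in> verts G" for u
    using that by (intro sum.cong refl SS)
  have S3: "X (Some (u, i)) (Some (v, i)) = X' (Some (u, i)) (Some (v, i))"
    if "i \<in> {1..t}" "u \<rightarrow>\<^bsub>G\<^esub> v" for i u v
    using that adj by (intro SS) auto
  show ?thesis
    \<comment> \<open>The deleted rules would rewrite \<open>i \<in> {1..t}\<close> and block the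
      match with the premises of the conditional equations; \<open>ball_cong\<close> makes that
      membership available.\<close>
    by (simp add: star_feasible_def N S1 S2 S3 del: One_nat_def atLeastAtMost_iff cong: ball_cong)
qed

lemma quantum_feasible_cong:
  assumes "wf_digraph G"
    and "\<And>k l. k \<in> colour_index G t \<Longrightarrow> l \<in> colour_index G t \<Longrightarrow> X k l = X' k l"
  shows "quantum_feasible G t X = quantum_feasible G t X'"
proof -
  have SS: "X (Some (u, i)) (Some (u, j)) = X' (Some (u, i)) (Some (u, j))"
    if "u \<in> verts G" "i \<in> {1..t}" "j \<in> {1..t}" for u i j
    using assms(2) that by (simp add: colour_index_def)
  have "star_feasible G t X = star_feasible G t X'"
    using assms by (rule star_feasible_cong)
  then show ?thesis
    by (simp add: quantum_feasible_def SS del: One_nat_def atLeastAtMost_iff cong: ball_cong)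
qed

text \<open>On \<open>I\<close> the members of the cone are exactly the Gram matrices of psd
  families; the assumption on \<open>P\<close> lets one replace \<open>X\<close> by
  \<open>gram Y\<close>, which may differ from it outside \<open>I\<close>. Symmetry of a Gram
  matrix comes from commutativity of the inner product.\<close>

lemma cs_plus_ex_iff_gram:
  assumes "\<And>X X'. (\<And>k l. k \<in> I \<Longrightarrow> l \<in> I \<Longrightarrow> X k l = X' k l) \<Longrightarrow> P X = P X'"
  shows "(\<exists>X\<in>cs_plus I. P X) \<longleftrightarrow> (\<exists>d\<ge>1. \<exists>Y. (\<forall>k\<in>I. Y k \<in> psd_mats d) \<and> P (gram Y))"
proof
  assume "\<exists>X\<in>cs_plus I. P X"
  then obtain X d Y where "P X" "d \<ge> 1" "\<forall>k\<in>I. Y k \<in> psd_mats d"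
    and "\<forall>k\<in>I. \<forall>l\<in>I. X k l = gram Y k l"
    by (auto simp: cs_plus_def gram_def)
  then show "\<exists>d\<ge>1. \<exists>Y. (\<forall>k\<in>I. Y k \<in> psd_mats d) \<and> P (gram Y)"
    using assms[of X "gram Y"] by blast
next
  assume "\<exists>d\<ge>1. \<exists>Y. (\<forall>k\<in>I. Y k \<in> psd_mats d) \<and> P (gram Y)"
  then obtain d Y where "d \<ge> 1" "\<forall>k\<in>I. Y k \<in> psd_mats d" "P (gram Y)" by blast
  moreover from this have "gram Y \<in> cs_plus I"
    unfolding cs_plus_def gram_def by (auto intro: trace_inner_psd_commute)
  ultimately show "\<exists>X\<in>cs_plus I. P X" by blast
qed

text \<open>The predicate \<open>A\<close> is kept abstract to serve both parameters. The assumption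
  \<open>star\<close> provides the psd conditions on \<open>\<rho>\<close> and \<open>R\<close>,
  without which the equivalence \<open>A\<close> could not be applied to the packed family.\<close>

lemma assignment_ex_iff_gram:
  assumes A: "\<And>d Y. (\<And>k. k \<in> colour_index G t \<Longrightarrow> Y k \<in> psd_mats d) \<Longrightarrow>
      A d (Y None) (\<lambda>u i. Y (Some (u, i))) \<longleftrightarrow> P (gram Y)"
    and star: "\<And>d \<rho> R. A d \<rho> R \<Longrightarrow> star_assignment G t d \<rho> R"
  shows "(\<exists>d\<ge>1. \<exists>\<rho> R. A d \<rho> R) \<longleftrightarrow>
    (\<exists>d\<ge>1. \<exists>Y. (\<forall>k\<in>colour_index G t. Y k \<in> psd_mats d) \<and> P (gram Y))"
proof
  assume "\<exists>d\<ge>1. \<exists>\<rho> R. A d \<rho> R"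
  then obtain d \<rho> R where d: "d \<ge> 1" and AR: "A d \<rho> R" by blast
  define Y where "Y = case_option \<rho> (case_prod R)"
  have Y: "Y k \<in> psd_mats d" if "k \<in> colour_index G t" for k
    using star[OF AR] that by (auto simp: star_assignment_def Y_def colour_index_def)
  have "A d (Y None) (\<lambda>u i. Y (Some (u, i)))" using AR by (simp add: Y_def)
  with Y have "P (gram Y)" by (subst (asm) A)
  with d Y show "\<exists>d\<ge>1. \<exists>Y. (\<forall>k\<in>colour_index G t. Y k \<in> psd_mats d) \<and> P (gram Y)"
    by (intro exI conjI ballI)
next
  assume "\<exists>d\<ge>1. \<exists>Y. (\<forall>k\<in>colour_index G t. Y k \<in> psd_mats d) \<and> P (gram Y)"
  then obtain d Y where d: "d \<ge> 1" and Y: "\<And>k. k \<in> colour_index G t \<Longrightarrow> Y k \<in> psd_mats d"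
    and P: "P (gram Y)" by blast
  from P have "A d (Y None) (\<lambda>u i. Y (Some (u, i)))" using Y by (subst A)
  with d show "\<exists>d\<ge>1. \<exists>\<rho> R. A d \<rho> R" by (intro exI conjI)
qed

lemma star_assignment_iff_cs_plus:
  assumes "wf_digraph G"
  shows "(\<exists>d\<ge>1. \<exists>\<rho> R. star_assignment G t d \<rho> R) \<longleftrightarrow>
    (\<exists>X\<in>cs_plus (colour_index G t). star_feasible G t X)"
proof -
  have "(\<exists>X\<in>cs_plus (colour_index G t). star_feasible G t X) \<longleftrightarrow>
      (\<exists>d\<ge>1. \<exists>Y. (\<forall>k\<in>colour_index G t. Y k \<in> psd_mats d) \<and> star_feasible G t (gram Y))"
    by (rule cs_plus_ex_iff_gram) (rule star_feasible_cong[OF assms])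
  moreover have "(\<exists>d\<ge>1. \<exists>\<rho> R. star_assignment G t d \<rho> R) \<longleftrightarrow>
      (\<exists>d\<ge>1. \<exists>Y. (\<forall>k\<in>colour_index G t. Y k \<in> psd_mats d) \<and> star_feasible G t (gram Y))"
    by (rule assignment_ex_iff_gram, rule star_assignment_iff_gram)
      (simp_all)
  ultimately show ?thesis by simp
qed

lemma quantum_assignment_iff_cs_plus:
  assumes "wf_digraph G"
  shows "(\<exists>d\<ge>1. \<exists>\<rho> R. quantum_assignment G t d \<rho> R) \<longleftrightarrow>
    (\<exists>X\<in>cs_plus (colour_index G t). quantum_feasible G t X)"
proof -
  have "(\<exists>X\<in>cs_plus (colour_index G t). quantum_feasible G t X) \<longleftrightarrow>
      (\<exists>d\<ge>1. \<exists>Y. (\<forall>k\<in>colour_index G t. Y k \<in> psd_mats d) \<and> quantum_feasible G t (gram Y))"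
    by (rule cs_plus_ex_iff_gram) (rule quantum_feasible_cong[OF assms])
  moreover have "(\<exists>d\<ge>1. \<exists>\<rho> R. quantum_assignment G t d \<rho> R) \<longleftrightarrow>
      (\<exists>d\<ge>1. \<exists>Y. (\<forall>k\<in>colour_index G t. Y k \<in> psd_mats d) \<and> quantum_feasible G t (gram Y))"
    by (rule assignment_ex_iff_gram, rule quantum_assignment_iff_gram)
      (simp_all add: quantum_assignment_def)
  ultimately show ?thesis by simp
qed

text \<open>Gives every vertex its own colour, with 1 by 1 matrices 0 and 1. A quantum assignment is
  also a star assignment, so this one witness makes both least values attained.\<close>

lemma quantum_assignment_exists:
  assumes "graph G" and "verts G \<noteq> {}"
  shows "\<exists>t\<ge>1. \<exists>d\<ge>1. \<exists>\<rho> R. quantum_assignment G t d \<rho> R"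
proof -
  interpret graph G by fact
  obtain f where f: "bij_betw f (verts G) {1..card (verts G)}"
    by (rule finite_same_card_bij[of "verts G" "{1..card (verts G)}", THEN exE]) simp_all
  define c where "c x = mat 1 1 (\<lambda>_. x)" for x :: real
  define R where "R u i = c (if f u = i then 1 else 0)" for u i
  have psd: "c x \<in> psd_mats 1" if "x \<ge> 0" for x
    using that by (auto simp: psd_mats_def c_def scalar_prod_def mat_eq_iff mult.left_commute)
  have R: "R u i \<in> psd_mats 1" for u i using psd[of 0] psd[of 1] by (simp add: R_def)
  have inner: "trace_inner (c x) (c y) = x * y" for x y
    by (simp add: trace_inner_def trace_mat_def c_def scalar_prod_def)
  \<comment> \<open>Loop-freeness makes \<open>u\<close> and \<open>v\<close> distinct, and
    \<open>f\<close> is injective on vertices.\<close>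
  have neq: "f u \<noteq> f v" if "u \<rightarrow>\<^bsub>G\<^esub> v" for u v
    using f that adj_in_verts[OF that] adj_not_same[of u]
    by (auto simp: bij_betw_def inj_on_def)
  have "mat_sum 1 (R u) {1..card (verts G)} = c 1" if "u \<in> verts G" for u
  proof -
    \<comment> \<open>The colour of \<open>u\<close> lies in the range of summation, so exactly one
      summand equals 1.\<close>
    have "f u \<in> {1..card (verts G)}" using f that by (auto simp: bij_betw_def)
    then have "(\<Sum>i\<in>{1..card (verts G)}. R u i $$ (0, 0)) = 1"
      by (simp add: R_def c_def if_distrib[of "\<lambda>x. mat 1 1 (\<lambda>_. x) $$ (0, 0)"] cong: if_cong)
    then show ?thesis by (auto simp: mat_sum_def c_def mat_eq_iff)
  qed
  then have "quantum_assignment G (card (verts G)) 1 (c 1) R"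
    using R psd unfolding quantum_assignment_def star_assignment_def
    by (auto simp: R_def inner dest: neq)
  moreover have "card (verts G) \<ge> 1"
    using assms(2) by (simp add: Suc_le_eq card_gt_0_iff)
  ultimately show ?thesis by blast
qed

text \<open>The existence hypothesis matters because \<open>LEAST\<close> satisfies its predicate
  only when some value does.\<close>

lemma is_minimum_Least: "\<exists>t. P t \<Longrightarrow> is_minimum (LEAST t. P t) P"
  by (auto simp: is_minimum_def intro: LeastI_ex Least_le)

theorem proposition4p10:
  fixes G :: "('v, 'e) pre_digraph"
  assumes "graph G" and "verts G \<noteq> {}"
  shows
    "is_minimum (chi_q G)
       (\<lambda>t. t \<ge> 1 \<and> (\<exists>X \<in> cs_plus (colour_index G t).
          X None None = 1 \<and>
          (\<forall>u \<in> verts G. (\<Sum>i\<in>{1..t}. X None (Some (u, i))) = 1) \<and>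
          (\<forall>u \<in> verts G. (\<Sum>i\<in>{1..t}. \<Sum>j\<in>{1..t}. X (Some (u, i)) (Some (u, j))) = 1) \<and>
          (\<forall>i \<in> {1..t}. \<forall>u v. u \<rightarrow>\<^bsub>G\<^esub> v \<longrightarrow> X (Some (u, i)) (Some (v, i)) = 0) \<and>
          (\<forall>u \<in> verts G. \<forall>i \<in> {1..t}. \<forall>j \<in> {1..t}. i \<noteq> j \<longrightarrow>
             X (Some (u, i)) (Some (u, j)) = 0)))
     \<and>
     is_minimum (chi_star G)
       (\<lambda>t. t \<ge> 1 \<and> (\<exists>X \<in> cs_plus (colour_index G t).
          X None None = 1 \<and>
          (\<forall>u \<in> verts G. (\<Sum>i\<in>{1..t}. X None (Some (u, i))) = 1) \<and>
          (\<forall>u \<in> verts G. (\<Sum>i\<in>{1..t}. \<Sum>j\<in>{1..t}. X (Some (u, i)) (Some (u, j))) = 1) \<and>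
          (\<forall>i \<in> {1..t}. \<forall>u v. u \<rightarrow>\<^bsub>G\<^esub> v \<longrightarrow> X (Some (u, i)) (Some (v, i)) = 0)))"
proof -
  have wf: "wf_digraph G" using assms(1) by (rule graph.axioms(1)[THEN digraph.axioms(1), THEN fin_digraph.axioms(1)])
  have q: "is_minimum (chi_q G) (\<lambda>t. t \<ge> 1 \<and> (\<exists>d\<ge>1. \<exists>\<rho> R. quantum_assignment G t d \<rho> R))"
    unfolding chi_q_def using quantum_assignment_exists[OF assms] by (intro is_minimum_Least)
  have s: "is_minimum (chi_star G) (\<lambda>t. t \<ge> 1 \<and> (\<exists>d\<ge>1. \<exists>\<rho> R. star_assignment G t d \<rho> R))"
    unfolding chi_star_def using quantum_assignment_exists[OF assms]
    by (intro is_minimum_Least) (auto simp: quantum_assignment_def)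
  \<comment> \<open>The equivalences hold for each fixed \<open>t\<close>, so they rewrite the
    predicates under the binder while the parameters stay as defined. \<open>conj_assoc\<close>
    flattens the conjunction nested inside \<open>quantum_feasible\<close>.\<close>
  show ?thesis
    using q s
    unfolding quantum_assignment_iff_cs_plus[OF wf] star_assignment_iff_cs_plus[OF wf]
      quantum_feasible_def star_feasible_def conj_assoc
    by (rule conjI)
qed

end
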